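(* Let $L_1$ and $L_2$ be finite-dimensional Lie $\mathbb{Q}$-algebras, nilpotent of class $2$, with $[L_i,L_i]=Z(L_i)$ for $i=1,2$. Write $L_1=V_1\oplus W_1$ and $L_2=V_2\oplus W_2$ as direct sums of $\mathbb{Q}$-linear spaces with $W_i=Z(L_i)$, and suppose $\dim V_1=\dim V_2=n$ and $\dim W_1=\dim W_2=m$. Then $E(L_1)\cong E(L_2)$ (as Lie algebras) if and only if $L_1\cong L_2$ (as Lie algebras).
   Context: Here nilpotent of class $2$ means $[[L,L],L]=0$. $Z(L)$ denotes the center of $L$. Construction of $E(L)$ for a finite-dimensional nilpotent class $2$ Lie $\mathbb{Q}$-algebra $L$ with $[L,L]=Z(L)$, written as $L=V\oplus W$ (direct sum of $\mathbb{Q}$-linear spaces) with $W=Z(L)$: let $\{v_1,\dots,v_n\}$ be a basis of $V$. Let $T$ be a $1$-dimensional $\mathbb{Q}$-linear space spanned by $t$, and let $U$ be an $n$-dimensional $\mathbb{Q}$-linear space with basis $\{u_1,\dots,u_n\}$. As a $\mathbb{Q}$-linear space $E(L)=U\oplus V\oplus T\oplus W$, and the Lie bracket is the bilinear skew-symmetric operation determined by: every element of $T\oplus W$ has zero bracket with every element of $E(L)$; $[u_i,u_j]=0$; $[u_i,v_j]=-[v_j,u_i]=\delta_{ij}t$; and $[v_i,v_j]$ is the same element of $W$ as in $L$ ($1\le i,j\le n$). $E(L_1)$ and $E(L_2)$ are formed from the given decompositions $L_i=V_i\oplus W_i$ and any choice of bases of $V_1$ and $V_2$. *)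

theory Defs
  imports Complex_Main "HOL-Library.Product_Plus" "HOL-Library.Function_Algebras"
begin

text \<open>
  A Lie algebra over the rationals is given by a subspace of an ambient rational vector space;
  the bracket is a total function of which only the values on that subspace matter.
\<close>

record 'a rat_lie =
  lie_space :: "'a set"
  lie_scale :: "rat \<Rightarrow> 'a \<Rightarrow> 'a"
  lie_bracket :: "'a \<Rightarrow> 'a \<Rightarrow> 'a"

definition lie_algebra :: "'a::ab_group_add rat_lie \<Rightarrow> bool" where
  "lie_algebra L \<longleftrightarrow>
     vector_space (lie_scale L) \<and>
     module.subspace (lie_scale L) (lie_space L) \<and>
     (\<forall>x\<in>lie_space L. \<forall>y\<in>lie_space L. lie_bracket L x y \<in> lie_space L) \<and>
     (\<forall>x\<in>lie_space L. \<forall>y\<in>lie_space L. \<forall>z\<in>lie_space L.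
        lie_bracket L (x + y) z = lie_bracket L x z + lie_bracket L y z \<and>
        lie_bracket L z (x + y) = lie_bracket L z x + lie_bracket L z y) \<and>
     (\<forall>r. \<forall>x\<in>lie_space L. \<forall>y\<in>lie_space L.
        lie_bracket L (lie_scale L r x) y = lie_scale L r (lie_bracket L x y) \<and>
        lie_bracket L x (lie_scale L r y) = lie_scale L r (lie_bracket L x y)) \<and>
     (\<forall>x\<in>lie_space L. lie_bracket L x x = 0) \<and>
     (\<forall>x\<in>lie_space L. \<forall>y\<in>lie_space L. \<forall>z\<in>lie_space L.
        lie_bracket L x (lie_bracket L y z) + lie_bracket L y (lie_bracket L z x)
          + lie_bracket L z (lie_bracket L x y) = 0)"

definition lie_isomorphic :: "'a::ab_group_add rat_lie \<Rightarrow> 'b::ab_group_add rat_lie \<Rightarrow> bool" where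
  "lie_isomorphic L M \<longleftrightarrow>
     (\<exists>f. bij_betw f (lie_space L) (lie_space M) \<and>
        (\<forall>x\<in>lie_space L. \<forall>y\<in>lie_space L. f (x + y) = f x + f y) \<and>
        (\<forall>r. \<forall>x\<in>lie_space L. f (lie_scale L r x) = lie_scale M r (f x)) \<and>
        (\<forall>x\<in>lie_space L. \<forall>y\<in>lie_space L. f (lie_bracket L x y) = lie_bracket M (f x) (f y)))"

definition lie_finite_dim :: "'a::ab_group_add rat_lie \<Rightarrow> bool" where
  "lie_finite_dim L \<longleftrightarrow> (\<exists>B. finite B \<and> module.span (lie_scale L) B = lie_space L)"

definition lie_bracket_space :: "'a::ab_group_add rat_lie \<Rightarrow> 'a set \<Rightarrow> 'a set \<Rightarrow> 'a set" where
  "lie_bracket_space L A B = module.span (lie_scale L) {lie_bracket L a b |a b. a \<in> A \<and> b \<in> B}"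

definition lie_derived :: "'a::ab_group_add rat_lie \<Rightarrow> 'a set" where
  "lie_derived L = lie_bracket_space L (lie_space L) (lie_space L)"

definition lie_center :: "'a::ab_group_add rat_lie \<Rightarrow> 'a set" where
  "lie_center L = {z \<in> lie_space L. \<forall>x\<in>lie_space L. lie_bracket L z x = 0}"

text \<open>Class 2 means \<open>[[L, L], L] = 0\<close>; abelian algebras are not excluded here.\<close>

definition lie_nilpotent_class2 :: "'a::ab_group_add rat_lie \<Rightarrow> bool" where
  "lie_nilpotent_class2 L \<longleftrightarrow> lie_bracket_space L (lie_derived L) (lie_space L) = {0}"

definition lie_direct_sum :: "'a::ab_group_add rat_lie \<Rightarrow> 'a set \<Rightarrow> 'a set \<Rightarrow> bool" where
  "lie_direct_sum L V W \<longleftrightarrow>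
     module.subspace (lie_scale L) V \<and> module.subspace (lie_scale L) W \<and>
     {v + w |v w. v \<in> V \<and> w \<in> W} = lie_space L \<and> V \<inter> W = {0}"

text \<open>The family \<open>v 0, \<dots>, v (n - 1)\<close> is a basis of \<open>V\<close>.\<close>

definition lie_basis :: "'a::ab_group_add rat_lie \<Rightarrow> 'a set \<Rightarrow> nat \<Rightarrow> (nat \<Rightarrow> 'a) \<Rightarrow> bool" where
  "lie_basis L V n v \<longleftrightarrow>
     inj_on v {..<n} \<and> \<not> module.dependent (lie_scale L) (v ` {..<n}) \<and>
     module.span (lie_scale L) (v ` {..<n}) = V"

definition lie_coord :: "'a::ab_group_add rat_lie \<Rightarrow> nat \<Rightarrow> (nat \<Rightarrow> 'a) \<Rightarrow> 'a \<Rightarrow> nat \<Rightarrow> rat" where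
  "lie_coord L n v x i = module.representation (lie_scale L) (v ` {..<n}) x (v i)"

text \<open>
  \<open>E(L) = U \<oplus> V \<oplus> T \<oplus> W\<close> consists of quadruples. The space \<open>U\<close> is the space of rational
  sequences vanishing from index \<open>n\<close> on, with \<open>u\<^sub>i\<close> the \<open>i\<close>-th unit sequence, and \<open>T\<close> is
  \<open>rat\<close> with \<open>t = 1\<close>. Expanding \<open>[u + x + s t + w, u' + x' + s' t + w']\<close> bilinearly, with
  \<open>u = \<Sum> a\<^sub>i u\<^sub>i\<close> and \<open>x = \<Sum> c\<^sub>i v\<^sub>i\<close> (and primed versions), the relations
  \<open>[u\<^sub>i, v\<^sub>j] = - [v\<^sub>j, u\<^sub>i] = \<delta>\<^sub>i\<^sub>j t\<close> contribute \<open>(\<Sum> (a\<^sub>i c'\<^sub>i - a'\<^sub>i c\<^sub>i)) t\<close>, and the \<open>V\<close>-parts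
  contribute the bracket \<open>[x, x']\<close> of \<open>L\<close>, an element of \<open>W\<close>.
\<close>

definition lie_E ::
  "'a::ab_group_add rat_lie \<Rightarrow> 'a set \<Rightarrow> 'a set \<Rightarrow> nat \<Rightarrow> (nat \<Rightarrow> 'a)
     \<Rightarrow> ((nat \<Rightarrow> rat) \<times> 'a \<times> rat \<times> 'a) rat_lie" where
  "lie_E L V W n v =
     \<lparr> lie_space = {a. \<forall>i\<ge>n. a i = 0} \<times> V \<times> UNIV \<times> W,
       lie_scale = (\<lambda>r (a, x, s, w). (\<lambda>i. r * a i, lie_scale L r x, r * s, lie_scale L r w)),
       lie_bracket = (\<lambda>(a, x, s, w) (a', x', s', w').
         (0, 0, \<Sum>i<n. a i * lie_coord L n v x' i - a' i * lie_coord L n v x i,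
          lie_bracket L x x')) \<rparr>"

text \<open>The following lemmas confirm that \<open>lie_E\<close> is a Lie algebra satisfying its defining relations.\<close>

lemma lie_coord_linear:
  assumes L: "lie_algebra L" and b: "lie_basis L V n v" and x: "x \<in> V"
  shows "y \<in> V \<Longrightarrow> lie_coord L n v (x + y) i = lie_coord L n v x i + lie_coord L n v y i"
    and "lie_coord L n v (lie_scale L r x) i = r * lie_coord L n v x i"
    and "lie_coord L n v 0 i = 0"
    and "i < n \<Longrightarrow> j < n \<Longrightarrow> lie_coord L n v (v j) i = (if i = j then 1 else 0)"
proof -
  interpret vector_space "lie_scale L" using L by (simp add: lie_algebra_def)
  have ind: "independent (v ` {..<n})" and sp: "span (v ` {..<n}) = V" and inj: "inj_on v {..<n}"
    using b by (auto simp: lie_basis_def)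
  show "y \<in> V \<Longrightarrow> lie_coord L n v (x + y) i = lie_coord L n v x i + lie_coord L n v y i"
    using x by (simp add: lie_coord_def representation_add[OF ind] sp)
  show "lie_coord L n v (lie_scale L r x) i = r * lie_coord L n v x i"
    using x by (simp add: lie_coord_def representation_scale[OF ind] sp)
  show "lie_coord L n v 0 i = 0"
    by (simp add: lie_coord_def representation_zero)
  show "i < n \<Longrightarrow> j < n \<Longrightarrow> lie_coord L n v (v j) i = (if i = j then 1 else 0)"
    using inj by (auto simp: lie_coord_def representation_basis[OF ind] inj_on_eq_iff)
qed

lemma lie_bracket_zero:
  assumes L: "lie_algebra L" and x: "x \<in> lie_space L"
  shows "lie_bracket L 0 x = 0" and "lie_bracket L x 0 = 0"
proof -
  interpret vector_space "lie_scale L" using L by (simp add: lie_algebra_def)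
  have 0: "0 \<in> lie_space L" using L unfolding lie_algebra_def by (simp add: subspace_0)
  have "lie_bracket L (0 + 0) x = lie_bracket L 0 x + lie_bracket L 0 x"
    and "lie_bracket L x (0 + 0) = lie_bracket L x 0 + lie_bracket L x 0"
    using L x 0 by (simp_all only: lie_algebra_def)
  then show "lie_bracket L 0 x = 0" and "lie_bracket L x 0 = 0" by simp_all
qed

lemma lie_direct_sum_subset:
  assumes L: "lie_algebra L" and dec: "lie_direct_sum L V W"
  shows "V \<subseteq> lie_space L" and "W \<subseteq> lie_space L" and "0 \<in> V" and "0 \<in> W"
proof -
  interpret vector_space "lie_scale L" using L by (simp add: lie_algebra_def)
  show 0: "0 \<in> V" "0 \<in> W" using dec unfolding lie_direct_sum_def by (simp_all add: subspace_0)
  have sum: "lie_space L = {v + w |v w. v \<in> V \<and> w \<in> W}" using dec by (simp add: lie_direct_sum_def)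
  show "V \<subseteq> lie_space L" unfolding sum using 0 by (force intro: exI[of _ 0])
  show "W \<subseteq> lie_space L" unfolding sum using 0 by (force intro: exI[of _ 0])
qed

lemma lie_E_relations:
  assumes L: "lie_algebra L" and dec: "lie_direct_sum L V W" and b: "lie_basis L V n v"
  defines "u \<equiv> \<lambda>i. ((\<lambda>k. if k = i then 1 else 0 :: rat), 0, 0, 0)"
    and "e \<equiv> \<lambda>i. (0, v i, 0, 0)"
    and "br \<equiv> lie_bracket (lie_E L V W n v)"
  shows "i < n \<Longrightarrow> j < n \<Longrightarrow> br (u i) (u j) = 0"
    and "i < n \<Longrightarrow> j < n \<Longrightarrow> br (u i) (e j) = (0, 0, if i = j then 1 else 0, 0)"
    and "i < n \<Longrightarrow> j < n \<Longrightarrow> br (e j) (u i) = (0, 0, if i = j then - 1 else 0, 0)"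
    and "i < n \<Longrightarrow> j < n \<Longrightarrow> br (e i) (e j) = (0, 0, 0, lie_bracket L (v i) (v j))"
    and "p \<in> lie_space (lie_E L V W n v) \<Longrightarrow> br (0, 0, s, w) p = 0"
    and "p \<in> lie_space (lie_E L V W n v) \<Longrightarrow> br p (0, 0, s, w) = 0"
proof -
  interpret vector_space "lie_scale L" using L by (simp add: lie_algebra_def)
  note sub = lie_direct_sum_subset[OF L dec]
  note lin = lie_coord_linear[OF L b sub(3)]
  have vV: "v k \<in> V" if "k < n" for k
    using b that span_base[of "v k" "v ` {..<n}"] by (auto simp: lie_basis_def)
  have z: "lie_bracket L 0 x = 0" "lie_bracket L x 0 = 0" if "x \<in> V" for x
    using lie_bracket_zero[OF L] sub that by auto
  show "i < n \<Longrightarrow> j < n \<Longrightarrow> br (u i) (u j) = 0"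
    by (simp add: br_def u_def lie_E_def lin z sub zero_prod_def)
  show "i < n \<Longrightarrow> j < n \<Longrightarrow> br (u i) (e j) = (0, 0, if i = j then 1 else 0, 0)"
    by (simp add: br_def u_def e_def lie_E_def lin z vV if_distrib[of "\<lambda>c. c * _"] cong: if_cong)
  show "i < n \<Longrightarrow> j < n \<Longrightarrow> br (e j) (u i) = (0, 0, if i = j then - 1 else 0, 0)"
    by (simp add: br_def u_def e_def lie_E_def lin z vV sum_negf if_distrib[of "\<lambda>c. c * _"] cong: if_cong)
  show "i < n \<Longrightarrow> j < n \<Longrightarrow> br (e i) (e j) = (0, 0, 0, lie_bracket L (v i) (v j))"
    by (simp add: br_def e_def lie_E_def)
  show "p \<in> lie_space (lie_E L V W n v) \<Longrightarrow> br (0, 0, s, w) p = 0"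
    by (cases p) (auto simp: br_def lie_E_def lin z zero_prod_def)
  show "p \<in> lie_space (lie_E L V W n v) \<Longrightarrow> br p (0, 0, s, w) = 0"
    by (cases p) (auto simp: br_def lie_E_def lin z zero_prod_def)
qed

lemma lie_algebra_lie_E:
  assumes L: "lie_algebra L" and dec: "lie_direct_sum L V W"
    and b: "lie_basis L V n v" and derived: "lie_derived L = W"
  shows "lie_algebra (lie_E L V W n v)"
proof -
  interpret vector_space "lie_scale L" using L by (simp add: lie_algebra_def)
  note sub = lie_direct_sum_subset[OF L dec]
  note zero = lie_coord_linear(3)[OF L b sub(3)]
  have V: "subspace V" and W: "subspace W" using dec unfolding lie_direct_sum_def by simp_all
  have brW: "lie_bracket L x y \<in> W" if "x \<in> V" "y \<in> V" for x y
    unfolding derived[symmetric] lie_derived_def lie_bracket_space_def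
    using sub that by (intro span_base) auto
  have z: "lie_bracket L 0 x = 0" "lie_bracket L x 0 = 0" if "x \<in> V" for x
    using lie_bracket_zero[OF L] sub that by auto
  have add: "lie_bracket L (x + y) z = lie_bracket L x z + lie_bracket L y z"
    "lie_bracket L z (x + y) = lie_bracket L z x + lie_bracket L z y"
    if "x \<in> V" "y \<in> V" "z \<in> V" for x y z
    using L subsetD[OF sub(1)] that by (simp_all only: lie_algebra_def)
  have scl: "lie_bracket L (lie_scale L r x) y = lie_scale L r (lie_bracket L x y)"
    "lie_bracket L x (lie_scale L r y) = lie_scale L r (lie_bracket L x y)"
    if "x \<in> V" "y \<in> V" for r x y
    using L subsetD[OF sub(1)] that by (simp_all only: lie_algebra_def)
  have alt: "lie_bracket L x x = 0" if "x \<in> V" for x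
    using L subsetD[OF sub(1)] that by (simp only: lie_algebra_def)
  let ?E = "lie_E L V W n v"
  have vs: "vector_space (lie_scale ?E)"
    by unfold_locales
      (auto simp: lie_E_def scale_right_distrib scale_left_distrib algebra_simps plus_fun_def)
  interpret E: vector_space "lie_scale ?E" by (rule vs)
  have subE: "E.subspace (lie_space ?E)"
    unfolding E.subspace_def
    by (auto simp: lie_E_def zero_prod_def subspace_0 subspace_add subspace_scale V W)
  show ?thesis
    unfolding lie_algebra_def
  proof (intro conjI ballI allI)
    show "vector_space (lie_scale ?E)" by (rule vs)
    show "E.subspace (lie_space ?E)" by (rule subE)
  next
    fix p q assume "p \<in> lie_space ?E" "q \<in> lie_space ?E"
    then show "lie_bracket ?E p q \<in> lie_space ?E"
      by (auto simp: lie_E_def brW sub)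
  next
    fix p q z assume pqz: "p \<in> lie_space ?E" "q \<in> lie_space ?E" "z \<in> lie_space ?E"
    then show "lie_bracket ?E (p + q) z = lie_bracket ?E p z + lie_bracket ?E q z"
      by (auto simp: lie_E_def add lie_coord_linear(1)[OF L b] algebra_simps sum.distrib sum_subtractf)
    from pqz show "lie_bracket ?E z (p + q) = lie_bracket ?E z p + lie_bracket ?E z q"
      by (auto simp: lie_E_def add lie_coord_linear(1)[OF L b] algebra_simps sum.distrib sum_subtractf)
    from pqz show "lie_bracket ?E p (lie_bracket ?E q z) + lie_bracket ?E q (lie_bracket ?E z p)
        + lie_bracket ?E z (lie_bracket ?E p q) = 0"
      by (auto simp: lie_E_def z zero zero_prod_def)
  next
    fix r p q assume pq: "p \<in> lie_space ?E" "q \<in> lie_space ?E"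
    then show "lie_bracket ?E (lie_scale ?E r p) q = lie_scale ?E r (lie_bracket ?E p q)"
      by (auto simp: lie_E_def scl lie_coord_linear(2)[OF L b] algebra_simps sum_distrib_left)
    from pq show "lie_bracket ?E p (lie_scale ?E r q) = lie_scale ?E r (lie_bracket ?E p q)"
      by (auto simp: lie_E_def scl lie_coord_linear(2)[OF L b] algebra_simps sum_distrib_left)
  next
    fix p assume "p \<in> lie_space ?E"
    then show "lie_bracket ?E p p = 0"
      by (auto simp: lie_E_def alt zero_prod_def)
  qed
qed

end

theory Submission
  imports Defs
begin

text \<open>
  Since \<open>W\<close> is the center, the bracket of \<open>L = V \<oplus> W\<close> is nothing but an alternating map
  \<open>V \<times> V \<rightarrow> W\<close>. Call \<open>L\<^sub>1\<close> and \<open>L\<^sub>2\<close> bracket equivalent if linear bijections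
  \<open>P : V\<^sub>1 \<rightarrow> V\<^sub>2\<close> and \<open>Q : W\<^sub>1 \<rightarrow> W\<^sub>2\<close> satisfy \<open>Q [x, y] = [P x, P y]\<close>. Both sides of the theorem
  amount to bracket equivalence.

  For \<open>L\<^sub>1 \<cong> L\<^sub>2\<close> this is the canonicity of the center: an isomorphism maps \<open>W\<^sub>1\<close> onto \<open>W\<^sub>2\<close>, so
  it induces a map on \<open>V \<cong> L / W\<close>; conversely \<open>P \<oplus> Q\<close> is an isomorphism
  (\<open>bracket_equiv_if_isomorphic\<close>, \<open>isomorphic_if_bracket_equiv\<close>).

  From \<open>(P, Q)\<close> one gets an isomorphism of the algebras \<open>E(L)\<close> by letting \<open>P\<close> act
  contragrediently on \<open>U\<close>, which the bracket of \<open>E(L)\<close> identifies with the dual of \<open>V\<close>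
  (\<open>E_isomorphic_if_bracket_equiv\<close>).

  The remaining direction rests on two subspaces of \<open>E(L)\<close> that are definable from its bracket.
  The first is the line \<open>T\<close> (\<open>E_iso_preserves_T\<close>): every noncentral \<open>p\<close> has \<open>t \<in> [p, E(L)]\<close>, because the
  pairing of \<open>U\<close> and \<open>V\<close> is perfect, while a nonzero \<open>u \<in> U\<close> has \<open>[u, E(L)] = T\<close>. So if
  \<open>V \<noteq> 0\<close>, then \<open>T\<close> is the intersection of the sets \<open>[p, E(L)]\<close> over all noncentral \<open>p\<close>; if \<open>V = 0\<close>,
  then \<open>L = 0\<close> and \<open>T\<close> is all of \<open>E(L)\<close>. The second is \<open>U \<oplus> T \<oplus> W\<close> (\<open>E_iso_preserves_UTW\<close>), the set of
  all \<open>p\<close> with \<open>[p, E(L)] \<subseteq> T\<close>: an \<open>x \<in> V\<close> that commutes with \<open>V\<close> is central in \<open>L\<close>, hence zero.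
  An isomorphism of the algebras \<open>E(L)\<close> therefore induces maps on \<open>E(L) / (U \<oplus> T \<oplus> W) \<cong> V\<close> and on
  \<open>(T \<oplus> W) / T \<cong> W\<close>, where \<open>T \<oplus> W\<close> is the center, and these two maps are \<open>P\<close> and \<open>Q\<close>
  (\<open>bracket_equiv_if_E_isomorphic\<close>). Here \<open>U\<close> itself need not be preserved, only \<open>U \<oplus> T \<oplus> W\<close>.
\<close>

section \<open>Isomorphisms\<close>

definition lin_bij :: "'a::ab_group_add rat_lie \<Rightarrow> 'a set \<Rightarrow> 'b::ab_group_add rat_lie \<Rightarrow> 'b set \<Rightarrow> ('a \<Rightarrow> 'b) \<Rightarrow> bool" where
  "lin_bij L A M B f \<longleftrightarrow> bij_betw f A B \<and>
     (\<forall>x\<in>A. \<forall>y\<in>A. f (x + y) = f x + f y) \<and>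
     (\<forall>r. \<forall>x\<in>A. f (lie_scale L r x) = lie_scale M r (f x))"

definition lie_iso :: "'a::ab_group_add rat_lie \<Rightarrow> 'b::ab_group_add rat_lie \<Rightarrow> ('a \<Rightarrow> 'b) \<Rightarrow> bool" where
  "lie_iso L M f \<longleftrightarrow> lin_bij L (lie_space L) M (lie_space M) f \<and>
     (\<forall>x\<in>lie_space L. \<forall>y\<in>lie_space L. f (lie_bracket L x y) = lie_bracket M (f x) (f y))"

lemma lie_isomorphic_iff: "lie_isomorphic L M \<longleftrightarrow> (\<exists>f. lie_iso L M f)"
  by (simp add: lie_isomorphic_def lie_iso_def lin_bij_def)

lemma lin_bijD:
  assumes "lin_bij L A M B f"
  shows "x \<in> A \<Longrightarrow> f x \<in> B"
    and "x \<in> A \<Longrightarrow> y \<in> A \<Longrightarrow> f (x + y) = f x + f y"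
    and "x \<in> A \<Longrightarrow> f (lie_scale L r x) = lie_scale M r (f x)"
  using assms by (auto simp: lin_bij_def bij_betw_def)

lemma lin_bijI:
  assumes "\<And>x. x \<in> A \<Longrightarrow> f x \<in> B" and "\<And>y. y \<in> B \<Longrightarrow> g y \<in> A"
    and "\<And>x. x \<in> A \<Longrightarrow> g (f x) = x" and "\<And>y. y \<in> B \<Longrightarrow> f (g y) = y"
    and "\<And>x y. x \<in> A \<Longrightarrow> y \<in> A \<Longrightarrow> f (x + y) = f x + f y"
    and "\<And>r x. x \<in> A \<Longrightarrow> f (lie_scale L r x) = lie_scale M r (f x)"
  shows "lin_bij L A M B f"
  using assms unfolding lin_bij_def by (auto intro!: bij_betw_byWitness[where f' = g])

lemma lin_bij_inverse:
  assumes f: "lin_bij L A M B f"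
    and add: "\<And>x y. x \<in> A \<Longrightarrow> y \<in> A \<Longrightarrow> x + y \<in> A"
    and scale: "\<And>r x. x \<in> A \<Longrightarrow> lie_scale L r x \<in> A"
  obtains g where "lin_bij M B L A g" and "\<And>x. x \<in> A \<Longrightarrow> g (f x) = x" and "\<And>y. y \<in> B \<Longrightarrow> f (g y) = y"
proof
  let ?g = "inv_into A f"
  have bij: "bij_betw f A B" using f by (simp add: lin_bij_def)
  note D = lin_bijD[OF f]
  show gf: "?g (f x) = x" if "x \<in> A" for x
    using bij that by (simp add: bij_betw_inv_into_left)
  show fg: "f (?g y) = y" if "y \<in> B" for y
    using bij that by (simp add: bij_betw_inv_into_right)
  have g: "bij_betw ?g B A" using bij by (rule bij_betw_inv_into)
  have gA: "?g y \<in> A" if "y \<in> B" for y using g that by (auto simp: bij_betw_def)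
  have "?g (x + y) = ?g x + ?g y" if "x \<in> B" "y \<in> B" for x y
    using gf[OF add[OF gA[OF that(1)] gA[OF that(2)]]] that by (simp add: D gA fg)
  moreover have "?g (lie_scale M r x) = lie_scale L r (?g x)" if "x \<in> B" for x r
    using gf[OF scale[OF gA[OF that]], of r] that by (simp add: D gA fg)
  ultimately show "lin_bij M B L A ?g" using g by (simp add: lin_bij_def)
qed

lemma lie_iso_inverse:
  assumes L: "lie_algebra L" and f: "lie_iso L M f"
  obtains g where "lie_iso M L g" and "\<And>x. x \<in> lie_space L \<Longrightarrow> g (f x) = x"
    and "\<And>y. y \<in> lie_space M \<Longrightarrow> f (g y) = y"
proof -
  interpret vector_space "lie_scale L" using L by (simp add: lie_algebra_def)
  have sub: "subspace (lie_space L)"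
    and br: "\<And>x y. x \<in> lie_space L \<Longrightarrow> y \<in> lie_space L \<Longrightarrow> lie_bracket L x y \<in> lie_space L"
    using L by (simp_all add: lie_algebra_def)
  have lf: "lin_bij L (lie_space L) M (lie_space M) f" using f by (simp add: lie_iso_def)
  obtain g where lg: "lin_bij M (lie_space M) L (lie_space L) g"
    and gf: "\<And>x. x \<in> lie_space L \<Longrightarrow> g (f x) = x" and fg: "\<And>y. y \<in> lie_space M \<Longrightarrow> f (g y) = y"
    by (rule lin_bij_inverse[OF lf subspace_add[OF sub] subspace_scale[OF sub]]) blast+
  have "g (lie_bracket M x y) = lie_bracket L (g x) (g y)" if "x \<in> lie_space M" "y \<in> lie_space M" for x y
  proof -
    have gxy: "g x \<in> lie_space L" "g y \<in> lie_space L" using lin_bijD(1)[OF lg] that by auto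
    have "lie_bracket M x y = f (lie_bracket L (g x) (g y))"
      using f gxy that by (simp add: lie_iso_def fg)
    then show ?thesis using gf[OF br[OF gxy]] by simp
  qed
  then have "lie_iso M L g" using lg by (simp add: lie_iso_def)
  then show thesis using that gf fg by blast
qed

lemma lie_iso_zero:
  assumes L: "lie_algebra L" and f: "lie_iso L M f"
  shows "f 0 = 0"
proof -
  interpret vector_space "lie_scale L" using L by (simp add: lie_algebra_def)
  have "0 \<in> lie_space L" using L by (simp add: lie_algebra_def subspace_0)
  then have "f (0 + 0) = f 0 + f 0" using f by (simp only: lie_iso_def lin_bij_def)
  then show ?thesis by simp
qed

lemma lie_iso_center:
  assumes L: "lie_algebra L" and f: "lie_iso L M f" and z: "z \<in> lie_center L"
  shows "f z \<in> lie_center M"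
proof -
  have surj: "\<exists>x\<in>lie_space L. y = f x" if "y \<in> lie_space M" for y
    using f that by (auto simp: lie_iso_def lin_bij_def bij_betw_def)
  have zL: "z \<in> lie_space L" and z0: "\<And>x. x \<in> lie_space L \<Longrightarrow> lie_bracket L z x = 0"
    using z by (simp_all add: lie_center_def)
  have "lie_bracket M (f z) (f x) = 0" if "x \<in> lie_space L" for x
    using f zL z0[OF that] that lie_iso_zero[OF L f] by (metis lie_iso_def)
  then have "lie_bracket M (f z) y = 0" if "y \<in> lie_space M" for y
    using surj[OF that] by blast
  moreover have "f z \<in> lie_space M"
    using f zL lin_bijD(1) unfolding lie_iso_def by blast
  ultimately show ?thesis by (simp add: lie_center_def)
qed

definition bracket_equiv ::
  "'a::ab_group_add rat_lie \<Rightarrow> 'a set \<Rightarrow> 'a set \<Rightarrow> 'b::ab_group_add rat_lie \<Rightarrow> 'b set \<Rightarrow> 'b set \<Rightarrow> bool" where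
  "bracket_equiv L V W L' V' W' \<longleftrightarrow>
     (\<exists>P Q. lin_bij L V L' V' P \<and> lin_bij L W L' W' Q \<and>
        (\<forall>x\<in>V. \<forall>y\<in>V. Q (lie_bracket L x y) = lie_bracket L' (P x) (P y)))"

section \<open>Splitting off the center\<close>

locale central_split =
  fixes L :: "'a::ab_group_add rat_lie" and V W :: "'a set" and n :: nat and v :: "nat \<Rightarrow> 'a"
  assumes lie: "lie_algebra L" and dec: "lie_direct_sum L V W" and center: "W = lie_center L"
    and derived: "lie_derived L = lie_center L" and basis: "lie_basis L V n v"
begin

sublocale vector_space "lie_scale L"
  using lie by (simp add: lie_algebra_def)

lemma subspaces: "subspace V" "subspace W" "subspace (lie_space L)"
  using dec lie by (simp_all add: lie_direct_sum_def lie_algebra_def)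

lemmas V_closed = subspace_0[OF subspaces(1)] subspace_add[OF subspaces(1)]
  subspace_scale[OF subspaces(1)] subspace_diff[OF subspaces(1)]
lemmas W_closed = subspace_0[OF subspaces(2)] subspace_add[OF subspaces(2)]
  subspace_scale[OF subspaces(2)] subspace_diff[OF subspaces(2)]
lemmas L_closed = subspace_0[OF subspaces(3)] subspace_add[OF subspaces(3)]
  subspace_scale[OF subspaces(3)] subspace_diff[OF subspaces(3)]

lemma V_sub: "x \<in> V \<Longrightarrow> x \<in> lie_space L" and W_sub: "x \<in> W \<Longrightarrow> x \<in> lie_space L"
  using lie_direct_sum_subset[OF lie dec] by auto

lemma decompose:
  assumes "z \<in> lie_space L"
  obtains x w where "x \<in> V" "w \<in> W" "z = x + w"
proof -
  have "z \<in> {x + w |x w. x \<in> V \<and> w \<in> W}" using assms dec by (simp add: lie_direct_sum_def)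
  then show thesis using that by blast
qed

lemma V_Int_W: "V \<inter> W = {0}"
  using dec by (simp add: lie_direct_sum_def)

lemma decompose_unique:
  assumes "x \<in> V" "y \<in> V" "w \<in> W" "w' \<in> W" "x + w = y + w'"
  shows "x = y"
proof -
  have "x - y = w' - w" using assms(5) by (simp add: algebra_simps)
  then have "x - y \<in> V \<inter> W"
    using V_closed(4)[OF assms(1,2)] W_closed(4)[OF assms(4,3)] by simp
  then show ?thesis by (simp add: V_Int_W)
qed

definition proj :: "'a \<Rightarrow> 'a" where
  "proj z = (THE x. x \<in> V \<and> z - x \<in> W)"

lemma proj_add_central: "x \<in> V \<Longrightarrow> w \<in> W \<Longrightarrow> proj (x + w) = x"
  unfolding proj_def
proof (rule the_equality)
  assume x: "x \<in> V" and w: "w \<in> W"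
  then show "x \<in> V \<and> x + w - x \<in> W" by simp
  fix y assume "y \<in> V \<and> x + w - y \<in> W"
  then show "y = x" using decompose_unique[of y x "x + w - y" w] x w by simp
qed

lemma bracket_add:
  assumes "x \<in> lie_space L" "y \<in> lie_space L" "z \<in> lie_space L"
  shows "lie_bracket L (x + y) z = lie_bracket L x z + lie_bracket L y z"
    and "lie_bracket L z (x + y) = lie_bracket L z x + lie_bracket L z y"
  using lie assms by (simp_all only: lie_algebra_def)

lemma bracket_in_W:
  assumes "x \<in> lie_space L" "y \<in> lie_space L"
  shows "lie_bracket L x y \<in> W"
  unfolding center derived[symmetric] lie_derived_def lie_bracket_space_def
  using assms by (intro span_base) auto

lemma bracket_anticommute:
  assumes x: "x \<in> lie_space L" and y: "y \<in> lie_space L"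
  shows "lie_bracket L x y = - lie_bracket L y x"
proof -
  have alt: "lie_bracket L z z = 0" if "z \<in> lie_space L" for z
    using lie that by (simp only: lie_algebra_def)
  have "lie_bracket L x y + lie_bracket L y x = lie_bracket L (x + y) (x + y)"
    using x y by (simp add: bracket_add L_closed alt[OF x] alt[OF y])
  also have "\<dots> = 0" by (rule alt[OF L_closed(2)[OF x y]])
  finally show ?thesis by (rule eq_neg_iff_add_eq_0[THEN iffD2])
qed

lemma bracket_central:
  assumes "w \<in> W" "y \<in> lie_space L"
  shows "lie_bracket L w y = 0" and "lie_bracket L y w = 0"
proof -
  show *: "lie_bracket L w y = 0" using assms center by (simp add: lie_center_def)
  show "lie_bracket L y w = 0" using bracket_anticommute[OF assms(2) W_sub[OF assms(1)]] * by simp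
qed

lemma bracket_decomposed:
  assumes "x \<in> V" "w \<in> W" "x' \<in> V" "w' \<in> W"
  shows "lie_bracket L (x + w) (x' + w') = lie_bracket L x x'"
  using assms by (simp add: bracket_add bracket_central V_sub W_sub L_closed)

lemma proj_in_V: "z \<in> lie_space L \<Longrightarrow> proj z \<in> V"
  and proj_diff_in_W: "z \<in> lie_space L \<Longrightarrow> z - proj z \<in> W"
  by (metis decompose proj_add_central add_diff_cancel_left')+

lemma proj_add:
  assumes z: "z \<in> lie_space L" and z': "z' \<in> lie_space L"
  shows "proj (z + z') = proj z + proj z'"
proof -
  have "z + z' = (proj z + proj z') + ((z - proj z) + (z' - proj z'))" by simp
  then show ?thesis
    using proj_add_central V_closed(2) W_closed(2) proj_in_V proj_diff_in_W z z' by metis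
qed

lemma proj_scale:
  assumes z: "z \<in> lie_space L"
  shows "proj (lie_scale L r z) = lie_scale L r (proj z)"
proof -
  have "lie_scale L r z = lie_scale L r (proj z) + lie_scale L r (z - proj z)"
    by (simp add: scale_right_diff_distrib)
  then show ?thesis
    using proj_add_central V_closed(3) W_closed(3) proj_in_V proj_diff_in_W z by metis
qed

lemma bracket_proj:
  assumes "z \<in> lie_space L" "z' \<in> lie_space L"
  shows "lie_bracket L (proj z) (proj z') = lie_bracket L z z'"
  using bracket_decomposed[of "proj z" "z - proj z" "proj z'" "z' - proj z'"] assms
  by (simp add: proj_in_V proj_diff_in_W)

lemma bracket_nondegenerate:
  assumes x: "x \<in> V" and zero: "\<And>y. y \<in> V \<Longrightarrow> lie_bracket L x y = 0"
  shows "x = 0"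
proof -
  have "lie_bracket L x z = 0" if z: "z \<in> lie_space L" for z
  proof -
    obtain y w where yw: "y \<in> V" "w \<in> W" "z = y + w" using z by (rule decompose)
    then show ?thesis
      using x zero[of y] by (simp add: bracket_add bracket_central V_sub W_sub)
  qed
  then have "x \<in> V \<inter> W" using x V_sub center by (simp add: lie_center_def)
  then show ?thesis by (simp add: V_Int_W)
qed

text \<open>
  If \<open>V = 0\<close>, then \<open>L\<close> equals its center and is abelian, so \<open>W = [L, L] = 0\<close>. This covers the case
  in which \<open>E(L)\<close> has no nonzero \<open>u \<in> U\<close> to work with.
\<close>

lemma W_trivial:
  assumes V: "V = {0}"
  shows "W = {0}"
proof -
  have "lie_bracket L a b = 0" if "a \<in> lie_space L" "b \<in> lie_space L" for a b
  proof -
    have "a \<in> W" using decompose[OF that(1)] V by (metis add_0 singletonD)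
    then show ?thesis using bracket_central(1) that by simp
  qed
  then have "{lie_bracket L a b |a b. a \<in> lie_space L \<and> b \<in> lie_space L} \<subseteq> {0}" by auto
  then have "W \<subseteq> {0}"
    unfolding center derived[symmetric] lie_derived_def lie_bracket_space_def
    by (rule span_minimal) (rule subspace_single_0)
  then show ?thesis using W_closed(1) by auto
qed

section \<open>The duality between \<open>U\<close> and \<open>V\<close>\<close>

text \<open>
  For \<open>u = \<Sum> a\<^sub>i u\<^sub>i\<close> in \<open>U\<close> the defining relations give \<open>[u, x] = (pairing a x) t\<close>.
\<close>

definition pairing :: "(nat \<Rightarrow> rat) \<Rightarrow> 'a \<Rightarrow> rat" where
  "pairing a x = (\<Sum>i<n. a i * lie_coord L n v x i)"

lemmas coord_linear = lie_coord_linear[OF lie basis]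

lemma basis_in_V: "i < n \<Longrightarrow> v i \<in> V"
  using basis span_base[of "v i" "v ` {..<n}"] by (auto simp: lie_basis_def)

lemma pairing_add_right: "x \<in> V \<Longrightarrow> y \<in> V \<Longrightarrow> pairing a (x + y) = pairing a x + pairing a y"
  and pairing_scale_right: "x \<in> V \<Longrightarrow> pairing a (lie_scale L r x) = r * pairing a x"
  by (simp_all add: pairing_def coord_linear algebra_simps sum.distrib sum_distrib_left)

lemma pairing_scale_left: "pairing (\<lambda>i. r * a i) x = r * pairing a x"
  and pairing_zero_left: "pairing 0 x = 0"
  by (simp_all add: pairing_def algebra_simps sum_distrib_left)

lemma pairing_zero_right: "pairing a 0 = 0"
  using pairing_scale_right[OF V_closed(1), of a 0] by simp

lemma pairing_basis: "j < n \<Longrightarrow> pairing a (v j) = a j"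
proof -
  assume j: "j < n"
  have "pairing a (v j) = (\<Sum>i<n. if i = j then a i else 0)"
    unfolding pairing_def using j by (intro sum.cong) (auto simp: coord_linear(4)[OF V_closed(1)])
  then show ?thesis using j by simp
qed

lemma functional_eq_pairing:
  assumes add: "\<And>x y. x \<in> V \<Longrightarrow> y \<in> V \<Longrightarrow> \<phi> (x + y) = \<phi> x + \<phi> y"
    and scale: "\<And>r x. x \<in> V \<Longrightarrow> \<phi> (lie_scale L r x) = r * \<phi> x"
    and a: "\<And>i. i < n \<Longrightarrow> a i = \<phi> (v i)" and x: "x \<in> V"
  shows "pairing a x = \<phi> x"
proof -
  have zero: "\<phi> 0 = 0" using scale[OF V_closed(1), of 0] by simp
  have V: "V = span (v ` {..<n})" using basis by (simp add: lie_basis_def)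
  have "x \<in> span (v ` {..<n})" using x V by simp
  then have "x \<in> V \<and> pairing a x = \<phi> x"
  proof (induction rule: span_induct_alt)
    case base
    then show ?case using zero pairing_zero_right V_closed(1) by simp
  next
    case (step c b y)
    then obtain i where "i < n" "b = v i" by auto
    then show ?case
      using step by (simp add: add scale pairing_add_right pairing_scale_right V_closed basis_in_V
          pairing_basis a)
  qed
  then show ?thesis by simp
qed

lemma pairing_nondegenerate:
  assumes x: "x \<in> V" and "x \<noteq> 0"
  obtains a where "\<And>i. i \<ge> n \<Longrightarrow> a i = 0" and "pairing a x = 1"
proof -
  have ind: "independent (v ` {..<n})" and sp: "x \<in> span (v ` {..<n})"
    using basis x by (auto simp: lie_basis_def)
  have "\<exists>i<n. lie_coord L n v x i \<noteq> 0"
  proof (rule ccontr)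
    assume "\<not> ?thesis"
    then have "(\<Sum>b\<in>v ` {..<n}. lie_scale L (representation (v ` {..<n}) x b) b) = 0"
      by (intro sum.neutral) (auto simp: lie_coord_def)
    then show False using sum_representation_eq[OF ind sp _ subset_refl] \<open>x \<noteq> 0\<close> by simp
  qed
  then obtain i where i: "i < n" and c: "lie_coord L n v x i \<noteq> 0" by blast
  let ?a = "\<lambda>k. if k = i then inverse (lie_coord L n v x i) else 0"
  have "pairing ?a x = (\<Sum>k<n. if k = i then inverse (lie_coord L n v x i) * lie_coord L n v x k else 0)"
    unfolding pairing_def by (intro sum.cong) auto
  also have "\<dots> = 1" using i c by simp
  finally show thesis using that[of ?a] i by auto
qed

section \<open>The algebra \<open>E(L)\<close>\<close>

abbreviation E :: "((nat \<Rightarrow> rat) \<times> 'a \<times> rat \<times> 'a) rat_lie" where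
  "E \<equiv> lie_E L V W n v"

lemma lie_algebra_E: "lie_algebra E"
  using lie_algebra_lie_E[OF lie dec basis] derived center by simp

lemma E_space: "(a, x, s, w) \<in> lie_space E \<longleftrightarrow> (\<forall>i\<ge>n. a i = 0) \<and> x \<in> V \<and> w \<in> W"
  by (simp add: lie_E_def)

lemma E_scale: "lie_scale E r (a, x, s, w) = ((\<lambda>i. r * a i), lie_scale L r x, r * s, lie_scale L r w)"
  by (simp add: lie_E_def)

lemma E_bracket:
  "lie_bracket E (a, x, s, w) (a', x', s', w') = (0, 0, pairing a x' - pairing a' x, lie_bracket L x x')"
  by (simp add: lie_E_def pairing_def sum_subtractf)

text \<open>
  The two halves of the perfect pairing serve the two cases for \<open>p = (a, x, s, w)\<close>. If \<open>x \<noteq> 0\<close>, the element \<open>q\<close> comes from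
  \<open>U\<close>, which commutes with everything except \<open>V\<close>. If \<open>x = 0\<close>, it comes from \<open>V\<close>, and no term in
  \<open>W\<close> arises because \<open>p\<close> has no component in \<open>V\<close>.
\<close>

lemma t_in_bracket_noncentral:
  assumes p: "(a, x, s, w) \<in> lie_space E" and nz: "a \<noteq> 0 \<or> x \<noteq> 0"
  obtains q where "q \<in> lie_space E" and "lie_bracket E (a, x, s, w) q = (0, 0, 1, 0)"
proof (cases "x = 0")
  case False
  obtain b where b: "\<And>i. i \<ge> n \<Longrightarrow> b i = 0" "pairing b x = 1"
    using p False pairing_nondegenerate[of x] by (auto simp: E_space)
  \<comment> \<open>The sign makes up for \<open>[v\<^sub>i, u\<^sub>i] = - t\<close>.\<close>
  let ?q = "(\<lambda>i. - 1 * b i, 0, 0, 0) :: (nat \<Rightarrow> rat) \<times> 'a \<times> rat \<times> 'a"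
  have "?q \<in> lie_space E" using b by (simp add: E_space V_closed W_closed)
  moreover have "lie_bracket E (a, x, s, w) ?q = (0, 0, 1, 0)"
    using p b pairing_zero_right
    unfolding E_bracket pairing_scale_left
    by (simp add: E_space bracket_central(2)[OF W_closed(1)] V_sub)
  ultimately show thesis by (rule that)
next
  case True
  then obtain i where i: "a i \<noteq> 0" using nz by (auto simp: fun_eq_iff)
  then have "i < n" using p by (auto simp: E_space not_le[symmetric])
  let ?q = "(0, lie_scale L (inverse (a i)) (v i), 0, 0) :: (nat \<Rightarrow> rat) \<times> 'a \<times> rat \<times> 'a"
  have "?q \<in> lie_space E" using \<open>i < n\<close> by (simp add: E_space V_closed W_closed basis_in_V)
  moreover have "lie_bracket E (a, x, s, w) ?q = (0, 0, 1, 0)"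
    using i \<open>i < n\<close> True
    by (simp add: E_bracket pairing_scale_right pairing_basis pairing_zero_left basis_in_V
        bracket_central(1)[OF W_closed(1)] V_sub V_closed)
  ultimately show thesis by (rule that)
qed

lemma E_center: "(a, x, s, w) \<in> lie_center E \<longleftrightarrow> a = 0 \<and> x = 0 \<and> w \<in> W"
proof
  assume c: "(a, x, s, w) \<in> lie_center E"
  then have p: "(a, x, s, w) \<in> lie_space E" by (simp add: lie_center_def)
  have "a = 0 \<and> x = 0"
  proof (rule ccontr)
    assume "\<not> ?thesis"
    then have "a \<noteq> 0 \<or> x \<noteq> 0" by simp
    from t_in_bracket_noncentral[OF p this] c show False
      by (auto simp: lie_center_def zero_prod_def)
  qed
  then show "a = 0 \<and> x = 0 \<and> w \<in> W" using p by (simp add: E_space)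
next
  assume "a = 0 \<and> x = 0 \<and> w \<in> W"
  then show "(a, x, s, w) \<in> lie_center E"
    by (auto simp: lie_center_def E_space V_closed E_bracket pairing_zero_left pairing_zero_right
        zero_prod_def bracket_central(1)[OF W_closed(1)] V_sub)
qed

end

section \<open>From isomorphic \<open>E(L)\<close> to equivalent brackets\<close>

text \<open>
  Take a nonzero \<open>u\<close> in the second \<open>U\<close>. Its preimage \<open>p\<close> is not central, so \<open>t = [p, q]\<close> for some
  \<open>q\<close>, and \<open>f t = [u, f q]\<close> lies in \<open>T\<close>.
\<close>

lemma E_iso_preserves_T:
  assumes "central_split L1 V1 W1 n v1" and "central_split L2 V2 W2 n' v2"
    and f: "lie_iso (lie_E L1 V1 W1 n v1) (lie_E L2 V2 W2 n' v2) f"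
  shows "\<exists>s'. f (0, 0, s, 0) = (0, 0, s', 0)"
proof -
  interpret A: central_split L1 V1 W1 n v1 by fact
  interpret B: central_split L2 V2 W2 n' v2 by fact
  have lf: "lin_bij A.E (lie_space A.E) B.E (lie_space B.E) f" using f by (simp add: lie_iso_def)
  have fbr: "f (lie_bracket A.E p q) = lie_bracket B.E (f p) (f q)"
    if "p \<in> lie_space A.E" "q \<in> lie_space A.E" for p q
    using f that by (simp add: lie_iso_def)
  obtain g where g: "lie_iso B.E A.E g" and gf: "\<And>x. x \<in> lie_space A.E \<Longrightarrow> g (f x) = x"
    and fg: "\<And>y. y \<in> lie_space B.E \<Longrightarrow> f (g y) = y"
    by (rule lie_iso_inverse[OF A.lie_algebra_E f]) blast
  have lg: "lin_bij B.E (lie_space B.E) A.E (lie_space A.E) g" using g by (simp add: lie_iso_def)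
  have t: "(0, 0, 1, 0) \<in> lie_space A.E" by (simp add: A.E_space A.V_closed A.W_closed)
  have "\<exists>s'. f (0, 0, 1, 0) = (0, 0, s', 0)"
  proof (cases "n' = 0")
    case True
    \<comment> \<open>There is no nonzero \<open>u\<close>, but then the whole second algebra is \<open>T\<close>.\<close>
    then have "V2 = {0}" using B.basis by (simp add: lie_basis_def)
    moreover from this have "W2 = {0}" by (rule B.W_trivial)
    moreover obtain a x r w where p: "f (0, 0, 1, 0) = (a, x, r, w)" by (cases "f (0, 0, 1, 0)")
    moreover have "(a, x, r, w) \<in> lie_space B.E" using lin_bijD(1)[OF lf t] p by simp
    then have "(\<forall>i\<ge>n'. a i = 0) \<and> x \<in> V2 \<and> w \<in> W2" by (rule B.E_space[THEN iffD1])
    ultimately show ?thesis using True by (simp add: fun_eq_iff)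
  next
    case False
    let ?u = "((\<lambda>i. if i = 0 then 1 else 0), 0, 0, 0) :: (nat \<Rightarrow> rat) \<times> 'b \<times> rat \<times> 'b"
    have u: "?u \<in> lie_space B.E" using False by (simp add: B.E_space B.V_closed B.W_closed)
    obtain a x r w where p: "g ?u = (a, x, r, w)" by (cases "g ?u")
    have pE: "(a, x, r, w) \<in> lie_space A.E" using lin_bijD(1)[OF lg u] p by simp
    have "a \<noteq> 0 \<or> x \<noteq> 0"
    proof (rule ccontr)
      assume "\<not> ?thesis"
      then have "g ?u \<in> lie_center A.E" using pE p by (simp add: A.E_center A.E_space)
      then have "?u \<in> lie_center B.E"
        using lie_iso_center[OF A.lie_algebra_E f] fg[OF u] by metis
      then have "?u = 0" by (simp add: B.E_center zero_prod_def)
      then show False by (simp add: zero_prod_def fun_eq_iff) (metis zero_neq_one)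
    qed
    from A.t_in_bracket_noncentral[OF pE this] obtain q
      where q: "q \<in> lie_space A.E" "lie_bracket A.E (a, x, r, w) q = (0, 0, 1, 0)" .
    have "f (0, 0, 1, 0) = lie_bracket B.E ?u (f q)"
      using fbr[OF pE q(1)] q(2) fg[OF u] p by simp
    then show ?thesis
      using lin_bijD(1)[OF lf q(1)]
      by (cases "f q") (auto simp: B.E_bracket B.E_space B.bracket_central(1)[OF B.W_closed(1)] B.V_sub)
  qed
  then obtain s' where s': "f (0, 0, 1, 0) = (0, 0, s', 0)" by blast
  have "f (lie_scale A.E s (0, 0, 1, 0)) = lie_scale B.E s (0, 0, s', 0)"
    using lin_bijD(3)[OF lf t] s' by simp
  then show ?thesis by (simp add: A.E_scale B.E_scale zero_fun_def)
qed

text \<open>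
  Elements of \<open>U \<oplus> T \<oplus> W\<close> have all their brackets in \<open>T\<close>, a property that \<open>f\<close> transports by the
  previous lemma. In the target it says that the \<open>V\<close>-component commutes with \<open>V\<close>.
\<close>

lemma E_iso_preserves_UTW:
  assumes "central_split L1 V1 W1 n v1" and "central_split L2 V2 W2 n' v2"
    and f: "lie_iso (lie_E L1 V1 W1 n v1) (lie_E L2 V2 W2 n' v2) f"
    and p: "(a, 0, s, w) \<in> lie_space (lie_E L1 V1 W1 n v1)"
  shows "fst (snd (f (a, 0, s, w))) = 0"
proof -
  interpret A: central_split L1 V1 W1 n v1 by fact
  interpret B: central_split L2 V2 W2 n' v2 by fact
  have lf: "lin_bij A.E (lie_space A.E) B.E (lie_space B.E) f" using f by (simp add: lie_iso_def)
  obtain a' x' s' w' where fp: "f (a, 0, s, w) = (a', x', s', w')" by (cases "f (a, 0, s, w)")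
  have fpE: "(a', x', s', w') \<in> lie_space B.E" using lin_bijD(1)[OF lf p] fp by simp
  have "lie_bracket L2 x' y = 0" if y: "y \<in> V2" for y
  proof -
    have "(0, y, 0, 0) \<in> lie_space B.E" using y by (simp add: B.E_space B.W_closed)
    moreover have "f ` lie_space A.E = lie_space B.E" using lf by (simp add: lin_bij_def bij_betw_def)
    ultimately obtain q where q: "q \<in> lie_space A.E" "f q = (0, y, 0, 0)" by (metis imageE)
    have "lie_bracket A.E (a, 0, s, w) q = (0, 0, A.pairing a (fst (snd q)), 0)"
      using q(1) by (cases q) (simp add: A.E_bracket A.E_space A.pairing_zero_right
          A.bracket_central(1)[OF A.W_closed(1)] A.V_sub)
    then obtain r where "lie_bracket A.E (a, 0, s, w) q = (0, 0, r, 0)" by blast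
    moreover obtain r' where "f (0, 0, r, 0) = (0, 0, r', 0)"
      using E_iso_preserves_T[OF assms(1-3)] by blast
    moreover have "f (lie_bracket A.E (a, 0, s, w) q) = lie_bracket B.E (a', x', s', w') (0, y, 0, 0)"
      using f p q fp by (simp add: lie_iso_def)
    ultimately have "lie_bracket B.E (a', x', s', w') (0, y, 0, 0) = (0, 0, r', 0)" by simp
    then show ?thesis by (simp add: B.E_bracket)
  qed
  then have "x' = 0" using B.bracket_nondegenerate fpE by (simp add: B.E_space)
  then show ?thesis using fp by simp
qed

text \<open>
  The map induced on \<open>V\<close>, seen as the quotient by \<open>U \<oplus> T \<oplus> W\<close>, is functorial; applied to \<open>f\<close> and its
  inverse this makes it bijective. The same holds for \<open>W\<close>, seen as the center modulo \<open>T\<close>.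
\<close>

lemma E_iso_V_inverse:
  assumes "central_split L1 V1 W1 n v1" and "central_split L2 V2 W2 n' v2"
    and f: "lie_iso (lie_E L1 V1 W1 n v1) (lie_E L2 V2 W2 n' v2) f"
    and g: "lie_iso (lie_E L2 V2 W2 n' v2) (lie_E L1 V1 W1 n v1) g"
    and gf: "\<And>p. p \<in> lie_space (lie_E L1 V1 W1 n v1) \<Longrightarrow> g (f p) = p"
    and x: "x \<in> V1"
  shows "fst (snd (g (0, fst (snd (f (0, x, 0, 0))), 0, 0))) = x"
proof -
  interpret A: central_split L1 V1 W1 n v1 by fact
  interpret B: central_split L2 V2 W2 n' v2 by fact
  have lf: "lin_bij A.E (lie_space A.E) B.E (lie_space B.E) f" using f by (simp add: lie_iso_def)
  have lg: "lin_bij B.E (lie_space B.E) A.E (lie_space A.E) g" using g by (simp add: lie_iso_def)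
  have xE: "(0, x, 0, 0) \<in> lie_space A.E" using x by (simp add: A.E_space A.W_closed)
  obtain a' x' s' w' where fx: "f (0, x, 0, 0) = (a', x', s', w')" by (cases "f (0, x, 0, 0)")
  have fxE: "(a', x', s', w') \<in> lie_space B.E" using lin_bijD(1)[OF lf xE] fx by simp
  then have E: "(0, x', 0, 0) \<in> lie_space B.E" "(a', 0, s', w') \<in> lie_space B.E"
    by (simp_all add: B.E_space B.W_closed B.V_closed)
  have "g ((0, x', 0, 0) + (a', 0, s', w')) = g (0, x', 0, 0) + g (a', 0, s', w')"
    by (rule lin_bijD(2)[OF lg E])
  then have "(0, x, 0, 0) = g (0, x', 0, 0) + g (a', 0, s', w')" using gf[OF xE] fx by simp
  then have "x = fst (snd (g (0, x', 0, 0))) + fst (snd (g (a', 0, s', w')))"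
    by (metis fst_add fst_conv snd_add snd_conv)
  then show ?thesis
    using E_iso_preserves_UTW[OF assms(2,1) g E(2)] fx by simp
qed

lemma E_iso_W_inverse:
  assumes "central_split L1 V1 W1 n v1" and "central_split L2 V2 W2 n' v2"
    and f: "lie_iso (lie_E L1 V1 W1 n v1) (lie_E L2 V2 W2 n' v2) f"
    and g: "lie_iso (lie_E L2 V2 W2 n' v2) (lie_E L1 V1 W1 n v1) g"
    and gf: "\<And>p. p \<in> lie_space (lie_E L1 V1 W1 n v1) \<Longrightarrow> g (f p) = p"
    and w: "w \<in> W1"
  shows "snd (snd (snd (g (0, 0, 0, snd (snd (snd (f (0, 0, 0, w)))))))) = w"
proof -
  interpret A: central_split L1 V1 W1 n v1 by fact
  interpret B: central_split L2 V2 W2 n' v2 by fact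
  have lf: "lin_bij A.E (lie_space A.E) B.E (lie_space B.E) f" using f by (simp add: lie_iso_def)
  have lg: "lin_bij B.E (lie_space B.E) A.E (lie_space A.E) g" using g by (simp add: lie_iso_def)
  have wE: "(0, 0, 0, w) \<in> lie_space A.E" using w by (simp add: A.E_space A.V_closed)
  have "(0, 0, 0, w) \<in> lie_center A.E" using w by (simp add: A.E_center)
  then have "f (0, 0, 0, w) \<in> lie_center B.E"
    by (rule lie_iso_center[OF A.lie_algebra_E f])
  then obtain s' w' where fw: "f (0, 0, 0, w) = (0, 0, s', w')" "w' \<in> W2"
    by (cases "f (0, 0, 0, w)") (auto simp: B.E_center)
  have E: "(0, 0, 0, w') \<in> lie_space B.E" "(0, 0, s', 0) \<in> lie_space B.E"
    using fw by (simp_all add: B.E_space B.W_closed B.V_closed)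
  obtain s where s: "g (0, 0, s', 0) = (0, 0, s, 0)"
    using E_iso_preserves_T[OF assms(2,1) g] by blast
  have "g ((0, 0, 0, w') + (0, 0, s', 0)) = g (0, 0, 0, w') + g (0, 0, s', 0)"
    by (rule lin_bijD(2)[OF lg E])
  then have "(0, 0, 0, w) = g (0, 0, 0, w') + (0, 0, s, 0)" using gf[OF wE] fw s by simp
  then show ?thesis using fw by (cases "g (0, 0, 0, w')") simp
qed

lemma bracket_equiv_if_E_isomorphic:
  assumes "central_split L1 V1 W1 n v1" and "central_split L2 V2 W2 n' v2"
    and iso: "lie_isomorphic (lie_E L1 V1 W1 n v1) (lie_E L2 V2 W2 n' v2)"
  shows "bracket_equiv L1 V1 W1 L2 V2 W2"
proof -
  interpret A: central_split L1 V1 W1 n v1 by fact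
  interpret B: central_split L2 V2 W2 n' v2 by fact
  obtain f where f: "lie_iso A.E B.E f" using iso by (auto simp: lie_isomorphic_iff)
  obtain g where g: "lie_iso B.E A.E g" and gf: "\<And>x. x \<in> lie_space A.E \<Longrightarrow> g (f x) = x"
    and fg: "\<And>y. y \<in> lie_space B.E \<Longrightarrow> f (g y) = y"
    by (rule lie_iso_inverse[OF A.lie_algebra_E f]) blast
  have lf: "lin_bij A.E (lie_space A.E) B.E (lie_space B.E) f" using f by (simp add: lie_iso_def)
  have lg: "lin_bij B.E (lie_space B.E) A.E (lie_space A.E) g" using g by (simp add: lie_iso_def)
  define P where "P x = fst (snd (f (0, x, 0, 0)))" for x
  define Q where "Q w = snd (snd (snd (f (0, 0, 0, w))))" for w
  have AV: "(0, x, 0, 0) \<in> lie_space A.E" if "x \<in> V1" for x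
    using that by (simp add: A.E_space A.W_closed)
  have AW: "(0, 0, 0, w) \<in> lie_space A.E" if "w \<in> W1" for w
    using that by (simp add: A.E_space A.V_closed)
  have BV: "(0, x, 0, 0) \<in> lie_space B.E" if "x \<in> V2" for x
    using that by (simp add: B.E_space B.W_closed)
  have BW: "(0, 0, 0, w) \<in> lie_space B.E" if "w \<in> W2" for w
    using that by (simp add: B.E_space B.V_closed)
  have A_comp: "fst (snd p) \<in> V1" "snd (snd (snd p)) \<in> W1" if "p \<in> lie_space A.E" for p
    using that by (cases p, simp add: A.E_space)+
  have B_comp: "fst (snd p) \<in> V2" "snd (snd (snd p)) \<in> W2" if "p \<in> lie_space B.E" for p
    using that by (cases p, simp add: B.E_space)+
  have B_scale: "fst (snd (lie_scale B.E r p)) = lie_scale L2 r (fst (snd p))"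
    "snd (snd (snd (lie_scale B.E r p))) = lie_scale L2 r (snd (snd (snd p)))" for r p
    by (cases p, simp add: B.E_scale)+
  have "lin_bij L1 V1 L2 V2 P"
  proof (rule lin_bijI[where g = "\<lambda>y. fst (snd (g (0, y, 0, 0)))"])
    show "P x \<in> V2" if "x \<in> V1" for x
      using B_comp(1)[OF lin_bijD(1)[OF lf AV[OF that]]] by (simp add: P_def)
    show "fst (snd (g (0, y, 0, 0))) \<in> V1" if "y \<in> V2" for y
      using A_comp(1)[OF lin_bijD(1)[OF lg BV[OF that]]] .
    show "fst (snd (g (0, P x, 0, 0))) = x" if "x \<in> V1" for x
      using E_iso_V_inverse[OF assms(1,2) f g gf that] by (simp add: P_def)
    show "P (fst (snd (g (0, y, 0, 0)))) = y" if "y \<in> V2" for y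
      using E_iso_V_inverse[OF assms(2,1) g f fg that] by (simp add: P_def)
    show "P (x + y) = P x + P y" if "x \<in> V1" "y \<in> V1" for x y
      using lin_bijD(2)[OF lf AV[OF that(1)] AV[OF that(2)]] by (simp add: P_def)
    show "P (lie_scale L1 r x) = lie_scale L2 r (P x)" if "x \<in> V1" for r x
      using lin_bijD(3)[OF lf AV[OF that], of r]
      by (simp add: P_def A.E_scale B_scale zero_fun_def[symmetric])
  qed
  moreover have "lin_bij L1 W1 L2 W2 Q"
  proof (rule lin_bijI[where g = "\<lambda>y. snd (snd (snd (g (0, 0, 0, y))))"])
    show "Q x \<in> W2" if "x \<in> W1" for x
      using B_comp(2)[OF lin_bijD(1)[OF lf AW[OF that]]] by (simp add: Q_def)
    show "snd (snd (snd (g (0, 0, 0, y)))) \<in> W1" if "y \<in> W2" for y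
      using A_comp(2)[OF lin_bijD(1)[OF lg BW[OF that]]] .
    show "snd (snd (snd (g (0, 0, 0, Q x)))) = x" if "x \<in> W1" for x
      using E_iso_W_inverse[OF assms(1,2) f g gf that] by (simp add: Q_def)
    show "Q (snd (snd (snd (g (0, 0, 0, y))))) = y" if "y \<in> W2" for y
      using E_iso_W_inverse[OF assms(2,1) g f fg that] by (simp add: Q_def)
    show "Q (x + y) = Q x + Q y" if "x \<in> W1" "y \<in> W1" for x y
      using lin_bijD(2)[OF lf AW[OF that(1)] AW[OF that(2)]] by (simp add: Q_def)
    show "Q (lie_scale L1 r x) = lie_scale L2 r (Q x)" if "x \<in> W1" for r x
      using lin_bijD(3)[OF lf AW[OF that], of r]
      by (simp add: Q_def A.E_scale B_scale zero_fun_def[symmetric])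
  qed
  moreover have "Q (lie_bracket L1 x y) = lie_bracket L2 (P x) (P y)" if "x \<in> V1" "y \<in> V1" for x y
  proof -
    have "(0, 0, 0, lie_bracket L1 x y) = lie_bracket A.E (0, x, 0, 0) (0, y, 0, 0)"
      by (simp add: A.E_bracket A.pairing_zero_left)
    then have "f (0, 0, 0, lie_bracket L1 x y) = lie_bracket B.E (f (0, x, 0, 0)) (f (0, y, 0, 0))"
      using f AV that by (simp add: lie_iso_def)
    then show ?thesis
      unfolding P_def Q_def
      by (cases "f (0, x, 0, 0)"; cases "f (0, y, 0, 0)") (simp add: B.E_bracket)
  qed
  ultimately show ?thesis unfolding bracket_equiv_def by blast
qed

section \<open>From equivalent brackets to isomorphic \<open>E(L)\<close>\<close>

text \<open>
  The map on coordinate sequences \<open>U\<^sub>1 \<rightarrow> U\<^sub>2\<close> dual to \<open>h : V\<^sub>2 \<rightarrow> V\<^sub>1\<close>: the functional with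
  coordinates \<open>a\<close> is composed with \<open>h\<close> and evaluated at the basis \<open>v'\<close>. Entries from \<open>n\<close> on are set
  to zero, as membership in \<open>U\<^sub>2\<close> demands.
\<close>

definition dual_transport ::
  "'a::ab_group_add rat_lie \<Rightarrow> nat \<Rightarrow> (nat \<Rightarrow> 'a) \<Rightarrow> ('b \<Rightarrow> 'a) \<Rightarrow> (nat \<Rightarrow> 'b) \<Rightarrow> (nat \<Rightarrow> rat) \<Rightarrow> nat \<Rightarrow> rat" where
  "dual_transport L n v h v' a =
     (\<lambda>j. if j < n then \<Sum>i<n. a i * lie_coord L n v (h (v' j)) i else 0)"

lemma pairing_dual_transport:
  assumes "central_split L1 V1 W1 n v1" and "central_split L2 V2 W2 n v2"
    and h: "lin_bij L2 V2 L1 V1 h" and y: "y \<in> V2"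
  shows "central_split.pairing L2 n v2 (dual_transport L1 n v1 h v2 a) y
    = central_split.pairing L1 n v1 a (h y)"
proof -
  interpret A: central_split L1 V1 W1 n v1 by fact
  interpret B: central_split L2 V2 W2 n v2 by fact
  note h = lin_bijD[OF h]
  show ?thesis
    by (rule B.functional_eq_pairing[OF _ _ _ y])
      (simp_all add: h A.pairing_add_right A.pairing_scale_right dual_transport_def A.pairing_def[symmetric])
qed

lemma dual_transport_inverse:
  assumes "central_split L1 V1 W1 n v1" and "central_split L2 V2 W2 n v2"
    and h: "lin_bij L2 V2 L1 V1 h" and k: "\<And>x. x \<in> V1 \<Longrightarrow> k x \<in> V2 \<and> h (k x) = x"
    and a: "\<And>i. i \<ge> n \<Longrightarrow> a i = 0"
  shows "dual_transport L2 n v2 k v1 (dual_transport L1 n v1 h v2 a) = a"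
proof
  interpret A: central_split L1 V1 W1 n v1 by fact
  interpret B: central_split L2 V2 W2 n v2 by fact
  fix i
  show "dual_transport L2 n v2 k v1 (dual_transport L1 n v1 h v2 a) i = a i"
  proof (cases "i < n")
    case True
    then have "dual_transport L2 n v2 k v1 (dual_transport L1 n v1 h v2 a) i
      = B.pairing (dual_transport L1 n v1 h v2 a) (k (v1 i))"
      by (simp add: dual_transport_def[of L2] B.pairing_def)
    also have "\<dots> = A.pairing a (v1 i)"
      using pairing_dual_transport[OF assms(1,2) h] k A.basis_in_V[OF True] by simp
    finally show ?thesis using A.pairing_basis[OF True] by simp
  next
    case False
    then show ?thesis using a by (simp add: dual_transport_def[of L2])
  qed
qed

text \<open>
  With the dual of \<open>P\<^sup>-\<^sup>1\<close> on \<open>U\<close> the pairing is preserved, which is the \<open>T\<close>-part of the bracket;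
  the \<open>W\<close>-part is preserved by the relation between \<open>P\<close> and \<open>Q\<close>.
\<close>

lemma E_isomorphic_if_bracket_equiv:
  assumes "central_split L1 V1 W1 n v1" and "central_split L2 V2 W2 n v2"
    and eq: "bracket_equiv L1 V1 W1 L2 V2 W2"
  shows "lie_isomorphic (lie_E L1 V1 W1 n v1) (lie_E L2 V2 W2 n v2)"
proof -
  interpret A: central_split L1 V1 W1 n v1 by fact
  interpret B: central_split L2 V2 W2 n v2 by fact
  obtain P Q where P: "lin_bij L1 V1 L2 V2 P" and Q: "lin_bij L1 W1 L2 W2 Q"
    and br: "\<And>x y. x \<in> V1 \<Longrightarrow> y \<in> V1 \<Longrightarrow> Q (lie_bracket L1 x y) = lie_bracket L2 (P x) (P y)"
    using eq unfolding bracket_equiv_def by blast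
  obtain P' where P': "lin_bij L2 V2 L1 V1 P'" and PP: "\<And>x. x \<in> V1 \<Longrightarrow> P' (P x) = x"
      "\<And>y. y \<in> V2 \<Longrightarrow> P (P' y) = y"
    by (rule lin_bij_inverse[OF P A.V_closed(2,3)]) blast+
  obtain Q' where Q': "lin_bij L2 W2 L1 W1 Q'" and QQ: "\<And>x. x \<in> W1 \<Longrightarrow> Q' (Q x) = x"
      "\<And>y. y \<in> W2 \<Longrightarrow> Q (Q' y) = y"
    by (rule lin_bij_inverse[OF Q A.W_closed(2,3)]) blast+
  note D = lin_bijD[OF P] lin_bijD[OF P'] lin_bijD[OF Q] lin_bijD[OF Q']
  let ?S = "dual_transport L1 n v1 P' v2"
  let ?S' = "dual_transport L2 n v2 P v1"
  define F where "F = (\<lambda>(a, x, s :: rat, w). (?S a, P x, s, Q w))"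
  define G where "G = (\<lambda>(a, x, s :: rat, w). (?S' a, P' x, s, Q' w))"
  have S: "?S' (?S a) = a" if "\<forall>i\<ge>n. a i = 0" for a
    using that by (intro dual_transport_inverse[OF assms(1,2) P']) (simp_all add: D PP)
  have S': "?S (?S' a) = a" if "\<forall>i\<ge>n. a i = 0" for a
    using that by (intro dual_transport_inverse[OF assms(2,1) P]) (simp_all add: D PP)
  have S0: "?S a i = 0" "?S' a i = 0" if "i \<ge> n" for a i
    using that by (simp_all add: dual_transport_def)
  have S_add: "?S (a + b) = ?S a + ?S b" for a b
    by (simp add: dual_transport_def fun_eq_iff algebra_simps sum.distrib)
  have S_scale: "?S (\<lambda>i. r * a i) = (\<lambda>i. r * ?S a i)" for r a
    by (simp add: dual_transport_def fun_eq_iff algebra_simps sum_distrib_left)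
  have S_pair: "B.pairing (?S a) (P x) = A.pairing a x" if "x \<in> V1" for a x
    using pairing_dual_transport[OF assms(1,2) P'] D that PP by simp
  have S_zero: "?S 0 = 0"
    by (simp add: dual_transport_def fun_eq_iff)
  have P_zero: "P 0 = 0" using lin_bijD(2)[OF P A.V_closed(1) A.V_closed(1)] by simp
  have "lin_bij A.E (lie_space A.E) B.E (lie_space B.E) F"
    by (rule lin_bijI[where g = G])
      (auto simp: F_def G_def A.E_space B.E_space A.E_scale B.E_scale D PP QQ S S' S0 S_add S_scale)
  moreover have "F (lie_bracket A.E p q) = lie_bracket B.E (F p) (F q)"
    if "p \<in> lie_space A.E" "q \<in> lie_space A.E" for p q
    using that by (cases p; cases q)
      (auto simp: F_def A.E_space A.E_bracket B.E_bracket S_pair S_zero P_zero br)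
  ultimately show ?thesis unfolding lie_isomorphic_iff lie_iso_def by blast
qed

section \<open>Isomorphic algebras and equivalent brackets\<close>

text \<open>
  An isomorphism need not map \<open>V\<^sub>1\<close> into \<open>V\<^sub>2\<close>, but it respects the centers. So \<open>f\<close> followed by the
  projection is the map induced on \<open>L / W\<close>, and the inverse of \<open>f\<close> induces its inverse.
\<close>

lemma lie_iso_proj_inverse:
  assumes "central_split L1 V1 W1 n v1" and "central_split L2 V2 W2 n' v2"
    and f: "lie_iso L1 L2 f" and g: "lie_iso L2 L1 g"
    and gf: "\<And>x. x \<in> lie_space L1 \<Longrightarrow> g (f x) = x" and x: "x \<in> V1"
  shows "central_split.proj V1 W1 (g (central_split.proj V2 W2 (f x))) = x"
proof -
  interpret A: central_split L1 V1 W1 n v1 by fact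
  interpret B: central_split L2 V2 W2 n' v2 by fact
  have lf: "lin_bij L1 (lie_space L1) L2 (lie_space L2) f"
    and lg: "lin_bij L2 (lie_space L2) L1 (lie_space L1) g"
    using f g by (simp_all add: lie_iso_def)
  obtain y w where y: "y \<in> V2" and w: "w \<in> W2" and fx: "f x = y + w"
    using B.decompose[OF lin_bijD(1)[OF lf A.V_sub[OF x]]] by blast
  have gw: "g w \<in> W1" "g w \<in> lie_space L1"
    using lie_iso_center[OF B.lie g, of w] w A.center B.center A.W_sub by auto
  have "x = g y + g w"
    using gf[OF A.V_sub[OF x]] fx lin_bijD(2)[OF lg B.V_sub[OF y] B.W_sub[OF w]] by simp
  then have "g y = x + - g w" by (simp add: algebra_simps)
  moreover have "- g w \<in> W1" using A.subspace_neg[OF A.subspaces(2) gw(1)] .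
  ultimately have "A.proj (g y) = x" using A.proj_add_central[OF x] by metis
  then show ?thesis using y w fx by (simp add: B.proj_add_central)
qed

lemma bracket_equiv_if_isomorphic:
  assumes "central_split L1 V1 W1 n v1" and "central_split L2 V2 W2 n' v2"
    and iso: "lie_isomorphic L1 L2"
  shows "bracket_equiv L1 V1 W1 L2 V2 W2"
proof -
  interpret A: central_split L1 V1 W1 n v1 by fact
  interpret B: central_split L2 V2 W2 n' v2 by fact
  obtain f where f: "lie_iso L1 L2 f" using iso by (auto simp: lie_isomorphic_iff)
  obtain g where g: "lie_iso L2 L1 g" and gf: "\<And>x. x \<in> lie_space L1 \<Longrightarrow> g (f x) = x"
    and fg: "\<And>y. y \<in> lie_space L2 \<Longrightarrow> f (g y) = y"
    by (rule lie_iso_inverse[OF A.lie f]) blast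
  have lf: "lin_bij L1 (lie_space L1) L2 (lie_space L2) f"
    and lg: "lin_bij L2 (lie_space L2) L1 (lie_space L1) g"
    using f g by (simp_all add: lie_iso_def)
  note D = lin_bijD[OF lf] lin_bijD[OF lg] A.V_sub A.W_sub B.V_sub B.W_sub
  have W: "f w \<in> W2" if "w \<in> W1" for w
    using lie_iso_center[OF A.lie f] that A.center B.center by simp
  have W': "g w \<in> W1" if "w \<in> W2" for w
    using lie_iso_center[OF B.lie g] that A.center B.center by simp
  define P where "P x = B.proj (f x)" for x
  have "lin_bij L1 V1 L2 V2 P"
  proof (rule lin_bijI[where g = "\<lambda>y. A.proj (g y)"])
    show "P x \<in> V2" if "x \<in> V1" for x
      using that by (simp add: P_def D B.proj_in_V)
    show "A.proj (g y) \<in> V1" if "y \<in> V2" for y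
      using that by (simp add: D A.proj_in_V)
    show "A.proj (g (P x)) = x" if "x \<in> V1" for x
      using lie_iso_proj_inverse[OF assms(1,2) f g gf that] by (simp add: P_def)
    show "P (A.proj (g y)) = y" if "y \<in> V2" for y
      using lie_iso_proj_inverse[OF assms(2,1) g f fg that] by (simp add: P_def)
    show "P (x + y) = P x + P y" if "x \<in> V1" "y \<in> V1" for x y
      using that by (simp add: P_def D B.proj_add)
    show "P (lie_scale L1 r x) = lie_scale L2 r (P x)" if "x \<in> V1" for r x
      using that by (simp add: P_def D B.proj_scale)
  qed
  moreover have "lin_bij L1 W1 L2 W2 f"
    by (rule lin_bijI[where g = g]) (simp_all add: D W W' gf fg)
  moreover have "f (lie_bracket L1 x y) = lie_bracket L2 (P x) (P y)" if "x \<in> V1" "y \<in> V1" for x y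
    using f that by (simp add: lie_iso_def D P_def B.bracket_proj)
  ultimately show ?thesis unfolding bracket_equiv_def by blast
qed

lemma isomorphic_if_bracket_equiv:
  assumes "central_split L1 V1 W1 n v1" and "central_split L2 V2 W2 n' v2"
    and eq: "bracket_equiv L1 V1 W1 L2 V2 W2"
  shows "lie_isomorphic L1 L2"
proof -
  interpret A: central_split L1 V1 W1 n v1 by fact
  interpret B: central_split L2 V2 W2 n' v2 by fact
  obtain P Q where P: "lin_bij L1 V1 L2 V2 P" and Q: "lin_bij L1 W1 L2 W2 Q"
    and br: "\<And>x y. x \<in> V1 \<Longrightarrow> y \<in> V1 \<Longrightarrow> Q (lie_bracket L1 x y) = lie_bracket L2 (P x) (P y)"
    using eq unfolding bracket_equiv_def by blast
  obtain P' where P': "lin_bij L2 V2 L1 V1 P'" and PP: "\<And>x. x \<in> V1 \<Longrightarrow> P' (P x) = x"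
      "\<And>y. y \<in> V2 \<Longrightarrow> P (P' y) = y"
    by (rule lin_bij_inverse[OF P A.V_closed(2,3)]) blast+
  obtain Q' where Q': "lin_bij L2 W2 L1 W1 Q'" and QQ: "\<And>x. x \<in> W1 \<Longrightarrow> Q' (Q x) = x"
      "\<And>y. y \<in> W2 \<Longrightarrow> Q (Q' y) = y"
    by (rule lin_bij_inverse[OF Q A.W_closed(2,3)]) blast+
  note D = lin_bijD[OF P] lin_bijD[OF P'] lin_bijD[OF Q] lin_bijD[OF Q']
  define F where "F z = P (A.proj z) + Q (z - A.proj z)" for z
  define G where "G z = P' (B.proj z) + Q' (z - B.proj z)" for z
  have F: "F (x + w) = P x + Q w" if "x \<in> V1" "w \<in> W1" for x w
    using that by (simp add: F_def A.proj_add_central)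
  have G: "G (x + w) = P' x + Q' w" if "x \<in> V2" "w \<in> W2" for x w
    using that by (simp add: G_def B.proj_add_central)
  have "lin_bij L1 (lie_space L1) L2 (lie_space L2) F"
  proof (rule lin_bijI[where g = G])
    show "F z \<in> lie_space L2" "G (F z) = z" if z: "z \<in> lie_space L1" for z
    proof -
      obtain x w where xw: "x \<in> V1" "w \<in> W1" "z = x + w" using A.decompose[OF z] .
      then show "F z \<in> lie_space L2" "G (F z) = z"
        by (simp_all add: F G D PP QQ B.V_sub B.W_sub B.L_closed)
    qed
    show "G z \<in> lie_space L1" "F (G z) = z" if z: "z \<in> lie_space L2" for z
    proof -
      obtain x w where xw: "x \<in> V2" "w \<in> W2" "z = x + w" using B.decompose[OF z] .
      then show "G z \<in> lie_space L1" "F (G z) = z"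
        by (simp_all add: F G D PP QQ A.V_sub A.W_sub A.L_closed)
    qed
    show "F (z + z') = F z + F z'" if z: "z \<in> lie_space L1" and z': "z' \<in> lie_space L1" for z z'
    proof -
      obtain x w where xw: "x \<in> V1" "w \<in> W1" "z = x + w" using A.decompose[OF z] .
      obtain x' w' where xw': "x' \<in> V1" "w' \<in> W1" "z' = x' + w'" using A.decompose[OF z'] .
      have "z + z' = (x + x') + (w + w')" using xw xw' by (simp add: algebra_simps)
      also have "F \<dots> = P (x + x') + Q (w + w')"
        using xw xw' by (intro F A.V_closed A.W_closed)
      also have "\<dots> = F z + F z'"
        unfolding xw(3) xw'(3) F[OF xw(1,2)] F[OF xw'(1,2)]
        by (simp add: D xw(1,2) xw'(1,2) add_ac)
      finally show ?thesis .
    qed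
    show "F (lie_scale L1 r z) = lie_scale L2 r (F z)" if z: "z \<in> lie_space L1" for r z
    proof -
      obtain x w where xw: "x \<in> V1" "w \<in> W1" "z = x + w" using A.decompose[OF z] .
      then show ?thesis
        by (simp add: F D A.V_closed A.W_closed A.scale_right_distrib B.scale_right_distrib)
    qed
  qed
  moreover have "F (lie_bracket L1 z z') = lie_bracket L2 (F z) (F z')"
    if z: "z \<in> lie_space L1" and z': "z' \<in> lie_space L1" for z z'
  proof -
    obtain x w where xw: "x \<in> V1" "w \<in> W1" "z = x + w" using A.decompose[OF z] .
    obtain x' w' where xw': "x' \<in> V1" "w' \<in> W1" "z' = x' + w'" using A.decompose[OF z'] .
    have P0: "P 0 = 0" using D(2)[OF A.V_closed(1) A.V_closed(1)] by simp
    have "F (0 + lie_bracket L1 x x') = P 0 + Q (lie_bracket L1 x x')"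
      using xw xw' by (intro F) (simp_all add: A.V_closed A.bracket_in_W A.V_sub)
    then show ?thesis
      using xw xw' by (simp add: A.bracket_decomposed F B.bracket_decomposed D P0 br)
  qed
  ultimately show ?thesis unfolding lie_isomorphic_iff lie_iso_def by blast
qed

theorem theorem1:
  fixes L1 :: "'a::ab_group_add rat_lie" and L2 :: "'b::ab_group_add rat_lie"
    and V1 W1 :: "'a set" and V2 W2 :: "'b set"
    and v1 :: "nat \<Rightarrow> 'a" and v2 :: "nat \<Rightarrow> 'b"
    and n m :: nat
  assumes "lie_algebra L1" and "lie_algebra L2"
    and "lie_finite_dim L1" and "lie_finite_dim L2"
    and "lie_nilpotent_class2 L1" and "lie_nilpotent_class2 L2"
    and "lie_derived L1 = lie_center L1" and "lie_derived L2 = lie_center L2"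
    and "lie_direct_sum L1 V1 W1" and "W1 = lie_center L1"
    and "lie_direct_sum L2 V2 W2" and "W2 = lie_center L2"
    and "vector_space.dim (lie_scale L1) V1 = n" and "vector_space.dim (lie_scale L2) V2 = n"
    and "vector_space.dim (lie_scale L1) W1 = m" and "vector_space.dim (lie_scale L2) W2 = m"
    and "lie_basis L1 V1 n v1" and "lie_basis L2 V2 n v2"
  shows "lie_isomorphic (lie_E L1 V1 W1 n v1) (lie_E L2 V2 W2 n v2) \<longleftrightarrow> lie_isomorphic L1 L2"
proof -
  have A: "central_split L1 V1 W1 n v1" and B: "central_split L2 V2 W2 n v2"
    using assms by (simp_all add: central_split_def)
  show ?thesis
    using bracket_equiv_if_E_isomorphic[OF A B] E_isomorphic_if_bracket_equiv[OF A B]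
      bracket_equiv_if_isomorphic[OF A B] isomorphic_if_bracket_equiv[OF A B] by blast
qed

end
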